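(* Let $\mathcal{A}$ and $\mathcal{B}$ be algebras and let $\varphi:\mathcal{A}\to\mathcal{B}$ be a $3$-Jordan homomorphism such that $\mathcal{B}$ is $\varphi$-commutative and $\varphi(ab-ba)=0$ for all $a,b\in\mathcal{A}$. Then $\varphi$ is a mixed Jordan homomorphism.
   Context: Algebras are complex and associative, not assumed unital or commutative. A $3$-Jordan homomorphism is a linear map $\varphi:\mathcal{A}\to\mathcal{B}$ with $\varphi(a^3)=\varphi(a)^3$ for all $a\in\mathcal{A}$. A mixed Jordan homomorphism is a linear map $\varphi$ with $\varphi(a^2b)=\varphi(a)^2\varphi(b)$ for all $a,b\in\mathcal{A}$. $\mathcal{B}$ is called $\varphi$-commutative if $\varphi(a)\varphi(b)=\varphi(b)\varphi(a)$ for all $a,b\in\mathcal{A}$. *)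

theory Defs
  imports Complex_Main
begin

text \<open>Associative algebras over the complex numbers. The class \<open>ring\<close> requires neither a unit
  nor commutativity; the carrier is the whole type.\<close>

locale complex_algebra = vector_space scale
  for scale :: "complex \<Rightarrow> 'a::ring \<Rightarrow> 'a" +
  assumes mult_scale_left: "scale c x * y = scale c (x * y)"
    and mult_scale_right: "x * scale c y = scale c (x * y)"

text \<open>Powers are written out as products since \<open>^\<close> is unavailable without a unit.\<close>

locale three_Jordan_hom =
  A: complex_algebra scaleA + B: complex_algebra scaleB + Vector_Spaces.linear scaleA scaleB \<phi>
  for scaleA :: "complex \<Rightarrow> 'a::ring \<Rightarrow> 'a"
    and scaleB :: "complex \<Rightarrow> 'b::ring \<Rightarrow> 'b"
    and \<phi> :: "'a \<Rightarrow> 'b" +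
  assumes map_cube: "\<phi> (a * a * a) = \<phi> a * \<phi> a * \<phi> a"

locale mixed_Jordan_hom =
  A: complex_algebra scaleA + B: complex_algebra scaleB + Vector_Spaces.linear scaleA scaleB \<phi>
  for scaleA :: "complex \<Rightarrow> 'a::ring \<Rightarrow> 'a"
    and scaleB :: "complex \<Rightarrow> 'b::ring \<Rightarrow> 'b"
    and \<phi> :: "'a \<Rightarrow> 'b" +
  assumes map_square_mult: "\<phi> (a * a * b) = \<phi> a * \<phi> a * \<phi> b"

definition map_commutative :: "('a \<Rightarrow> 'b::ring) \<Rightarrow> bool"
  where "map_commutative \<phi> \<longleftrightarrow> (\<forall>a b. \<phi> a * \<phi> b = \<phi> b * \<phi> a)"

end

theory Submission
  imports Defs
begin

text \<open>
  Polarisation: the part of \<open>(a + b)\<^sup>3\<close> that is odd in \<open>b\<close> is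
  \<open>aab + aba + baa + b\<^sup>3\<close>, and it is isolated by comparing \<open>(a + b)\<^sup>3\<close> with \<open>(a - b)\<^sup>3\<close>.
  Applying \<open>\<phi>\<close> shows that \<open>\<phi>\<close> respects the sum \<open>aab + aba + baa\<close> up to a factor \<open>2\<close>.
  A map that vanishes on commutators is invariant under cyclic rotation of a product, like a
  trace, so it takes the same value on the three words; since the values of \<open>\<phi>\<close> commute, the
  three words in \<open>\<phi> a\<close>, \<open>\<phi> a\<close>, \<open>\<phi> b\<close> agree as well. What remains is the desired identity
  multiplied by \<open>6\<close>, which can be cancelled in a complex vector space.
\<close>

lemma (in vector_space) double_cancel:
  fixes x y :: 'b
  assumes "(2::'a) \<noteq> 0" and "x + x = y + y"
  shows "x = y"
proof -
  have "scale 2 z = z + z" for z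
    using scale_left_distrib[of 1 1 z] by simp
  then have "scale 2 x = scale 2 y"
    using assms(2) by simp
  then show ?thesis
    using assms(1) by simp
qed

lemma (in vector_space) triple_cancel:
  fixes x y :: 'b
  assumes "(3::'a) \<noteq> 0" and "x + x + x = y + y + y"
  shows "x = y"
proof -
  have "scale 3 z = z + z + z" for z
    using scale_left_distrib[of 2 1 z] scale_left_distrib[of 1 1 z] by simp
  then have "scale 3 x = scale 3 y"
    using assms(2) by simp
  then show ?thesis
    using assms(1) by simp
qed

lemma cube_add_minus_cube_diff:
  fixes x y :: "'r::ring"
  shows "(x + y) * (x + y) * (x + y) - (x - y) * (x - y) * (x - y) =
    (x * x * y + x * y * x + y * x * x + y * y * y) +
    (x * x * y + x * y * x + y * x * x + y * y * y)"
  by (simp add: algebra_simps)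

lemma (in three_Jordan_hom) polarized_cube:
  "\<phi> (a * a * b + a * b * a + b * a * a) =
    \<phi> a * \<phi> a * \<phi> b + \<phi> a * \<phi> b * \<phi> a + \<phi> b * \<phi> a * \<phi> a"
proof -
  let ?s = "a * a * b + a * b * a + b * a * a + b * b * b"
  let ?t = "\<phi> a * \<phi> a * \<phi> b + \<phi> a * \<phi> b * \<phi> a + \<phi> b * \<phi> a * \<phi> a + \<phi> b * \<phi> b * \<phi> b"
  have "\<phi> ?s + \<phi> ?s = \<phi> ((a + b) * (a + b) * (a + b) - (a - b) * (a - b) * (a - b))"
    by (simp only: cube_add_minus_cube_diff add)
  also have "\<dots> = (\<phi> a + \<phi> b) * (\<phi> a + \<phi> b) * (\<phi> a + \<phi> b)
      - (\<phi> a - \<phi> b) * (\<phi> a - \<phi> b) * (\<phi> a - \<phi> b)"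
    by (simp only: diff add map_cube)
  also have "\<dots> = ?t + ?t"
    by (rule cube_add_minus_cube_diff)
  finally have "\<phi> ?s = ?t"
    by (rule B.double_cancel[rotated]) simp
  then show ?thesis
    by (simp add: add map_cube)
qed

theorem theorem2p7:
  fixes scaleA :: "complex \<Rightarrow> 'a::ring \<Rightarrow> 'a"
    and scaleB :: "complex \<Rightarrow> 'b::ring \<Rightarrow> 'b"
    and \<phi> :: "'a \<Rightarrow> 'b"
  assumes "complex_algebra scaleA"
    and "complex_algebra scaleB"
    and "three_Jordan_hom scaleA scaleB \<phi>"
    and "map_commutative \<phi>"
    and "\<And>a b. \<phi> (a * b - b * a) = 0"
  shows "mixed_Jordan_hom scaleA scaleB \<phi>"
proof -
  interpret three_Jordan_hom scaleA scaleB \<phi>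
    by fact
  have rotate: "\<phi> (x * y) = \<phi> (y * x)" for x y
    using assms(5)[of x y] by (simp add: diff)
  have comm: "\<phi> x * \<phi> y = \<phi> y * \<phi> x" for x y
    using assms(4) by (simp add: map_commutative_def)
  have "\<phi> (a * a * b) = \<phi> a * \<phi> a * \<phi> b" for a b
  proof -
    have words: "\<phi> (a * b * a) = \<phi> (a * a * b)" "\<phi> (b * a * a) = \<phi> (a * a * b)"
      using rotate[of "a * b" a] rotate[of b "a * a"] by (simp_all add: mult.assoc)
    have images: "\<phi> a * \<phi> b * \<phi> a = \<phi> a * \<phi> a * \<phi> b" "\<phi> b * \<phi> a * \<phi> a = \<phi> a * \<phi> a * \<phi> b"
      using comm[of b a] by (simp_all add: mult.assoc)
    show ?thesis
      by (rule B.triple_cancel[rotated]) (use polarized_cube[of a b] in \<open>simp_all add: add words images\<close>)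
  qed
  then show ?thesis
    by unfold_locales
qed

end
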